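(* Let $A \in \mathbb{R}^{n \times n}$ and $D \in \mathbb{R}^{p \times p}$ be symmetric positive definite matrices, let $B \in \mathbb{R}^{m \times n}$ be of full row rank, let $C \in \mathbb{R}^{p \times n}$ be rank-deficient, and let $\alpha > 0$ and $\beta > 0$. Let $\tilde{\mathcal{A}}$, $\mathcal{Q}$, $\mathcal{L}$ and $\mathcal{G}_{\alpha,\beta} = \mathcal{Q}^{-1}\mathcal{L}$ be the matrices defined in the context, let $\mathbf{d} \in \mathbb{R}^{n+m+p}$, and define $$\mathcal{D} = \left\{\, x \in \mathbb{R}^{n} : (x; y; z) \text{ is an eigenvector of } \mathcal{G}_{\alpha,\beta} \text{ with } \|x\|_2 = 1 \,\right\}.$$ Then the iterative method $$\mathbf{u}^{(k+1)} = \mathcal{G}_{\alpha,\beta}\mathbf{u}^{(k)} + \mathcal{Q}^{-1}\mathbf{d}, \qquad k = 0,1,2,\ldots,$$ converges to the unique solution of the system $\tilde{\mathcal{A}}\mathbf{u} = \mathbf{d}$ for any initial guess $\mathbf{u}^{(0)}$ if and only if $$c - a < \gamma b$$ for every $$a = x^{*} A x > 0, \qquad b = x^{*} B^{T} B x \ge 0, \qquad c = x^{*} C^{T} D^{-1} C x \ge 0,$$ with $x \in \mathcal{D}$, where $\gamma = 2\alpha + \frac{1}{2\beta}$.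
   Context: Given $A, B, C, D$ and $\alpha, \beta > 0$ as in the claim, define the following $3\times 3$ block matrices of order $n+m+p$ (with block sizes $n, m, p$): $$\tilde{\mathcal{A}} = \begin{pmatrix} A & B^{T} & C^{T} \\ B & 0 & 0 \\ C & 0 & -D \end{pmatrix}, \quad \mathcal{Q} = \begin{pmatrix} A + \alpha B^{T}B & B^T & 0 \\ B & -\beta I & 0 \\ C & 0 & -D \end{pmatrix}, \quad \mathcal{L} = \begin{pmatrix} \alpha B^{T}B & 0 & -C^{T} \\ 0 & -\beta I & 0 \\ 0 & 0 & 0 \end{pmatrix},$$ so that $\tilde{\mathcal{A}} = \mathcal{Q} - \mathcal{L}$. Both $\tilde{\mathcal{A}}$ and $\mathcal{Q}$ are nonsingular. The iteration matrix is $\mathcal{G}_{\alpha,\beta} = \mathcal{Q}^{-1}\mathcal{L}$. The notation $(x;y;z)$ denotes the column vector obtained by stacking $x$, $y$, $z$ (of lengths $n$, $m$, $p$) vertically, and $x^*$ denotes the conjugate transpose of $x$. "Rank-deficient" means that the rank is less than $\min\{p,n\}$. *)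

theory Defs
  imports "HOL-Analysis.Analysis"
begin

definition spd :: "real^'n^'n \<Rightarrow> bool" where
  "spd A \<longleftrightarrow> transpose A = A \<and> (\<forall>x. x \<noteq> 0 \<longrightarrow> x \<bullet> (A *v x) > 0)"

definition stack3 :: "'a^'n \<Rightarrow> 'a^'m \<Rightarrow> 'a^'p \<Rightarrow> 'a^('n + 'm + 'p)" where
  "stack3 x y z = (\<chi> i. case i of Inl i \<Rightarrow> x $ i | Inr (Inl i) \<Rightarrow> y $ i | Inr (Inr i) \<Rightarrow> z $ i)"

(* The nine blocks are listed row by row; R^(n+m+p) is indexed by the sum type 'n + 'm + 'p. *)
definition block3 ::
  "'a^'n^'n \<Rightarrow> 'a^'m^'n \<Rightarrow> 'a^'p^'n \<Rightarrow>
   'a^'n^'m \<Rightarrow> 'a^'m^'m \<Rightarrow> 'a^'p^'m \<Rightarrow>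
   'a^'n^'p \<Rightarrow> 'a^'m^'p \<Rightarrow> 'a^'p^'p \<Rightarrow>
   'a^('n + 'm + 'p)^('n + 'm + 'p)" where
  "block3 A11 A12 A13 A21 A22 A23 A31 A32 A33 =
     (\<chi> i. case i of
        Inl r \<Rightarrow> stack3 (A11 $ r) (A12 $ r) (A13 $ r)
      | Inr (Inl r) \<Rightarrow> stack3 (A21 $ r) (A22 $ r) (A23 $ r)
      | Inr (Inr r) \<Rightarrow> stack3 (A31 $ r) (A32 $ r) (A33 $ r))"

definition saddle_mat ::
  "real^'n^'n \<Rightarrow> real^'n^'m \<Rightarrow> real^'n^'p \<Rightarrow> real^'p^'p \<Rightarrow> real^('n + 'm + 'p)^('n + 'm + 'p)" where
  "saddle_mat A B C D =
     block3 A (transpose B) (transpose C)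
            B 0             0
            C 0             (- D)"

definition Q_mat ::
  "real^'n^'n \<Rightarrow> real^'n^'m \<Rightarrow> real^'n^'p \<Rightarrow> real^'p^'p \<Rightarrow> real \<Rightarrow> real \<Rightarrow>
   real^('n + 'm + 'p)^('n + 'm + 'p)" where
  "Q_mat A B C D \<alpha> \<beta> =
     block3 (A + \<alpha> *\<^sub>R (transpose B ** B)) (transpose B)      0
            B                               (- (\<beta> *\<^sub>R mat 1)) 0
            C                               0                  (- D)"

definition L_mat ::
  "real^'n^'m \<Rightarrow> real^'n^'p \<Rightarrow> real \<Rightarrow> real \<Rightarrow> real^('n + 'm + 'p)^('n + 'm + 'p)" where
  "L_mat B C \<alpha> \<beta> =
     block3 (\<alpha> *\<^sub>R (transpose B ** B)) 0                  (- transpose C)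
            0                           (- (\<beta> *\<^sub>R mat 1)) 0
            0                           0                  0"

lemma saddle_mat_splitting: "saddle_mat A B C D = Q_mat A B C D \<alpha> \<beta> - L_mat B C \<alpha> \<beta>"
  unfolding saddle_mat_def Q_mat_def L_mat_def block3_def stack3_def
  by (simp add: vec_eq_iff split: sum.split)

definition G_mat ::
  "real^'n^'n \<Rightarrow> real^'n^'m \<Rightarrow> real^'n^'p \<Rightarrow> real^'p^'p \<Rightarrow> real \<Rightarrow> real \<Rightarrow>
   real^('n + 'm + 'p)^('n + 'm + 'p)" where
  "G_mat A B C D \<alpha> \<beta> = matrix_inv (Q_mat A B C D \<alpha> \<beta>) ** L_mat B C \<alpha> \<beta>"

definition is_eigenvector :: "'a::field^'n^'n \<Rightarrow> 'a^'n \<Rightarrow> bool" where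
  "is_eigenvector M v \<longleftrightarrow> v \<noteq> 0 \<and> (\<exists>\<mu>. M *v v = \<mu> *s v)"

(* Eigenvectors are taken over the complex numbers: the eigenvalue and the components y, z
   may be complex, only x is required to be real. *)
definition D_set ::
  "real^'n^'n \<Rightarrow> real^'n^'m \<Rightarrow> real^'n^'p \<Rightarrow> real^'p^'p \<Rightarrow> real \<Rightarrow> real \<Rightarrow> (real^'n) set" where
  "D_set A B C D \<alpha> \<beta> =
     {x. norm x = 1 \<and>
         (\<exists>y z. is_eigenvector (map_matrix complex_of_real (G_mat A B C D \<alpha> \<beta>))
                            (stack3 (\<chi> i. complex_of_real (x $ i)) y z))}"

end

theory Submission
  imports Defs
begin

text \<open>
Write \<open>E = B\<^sup>T B\<close> and \<open>S = C\<^sup>T D\<^sup>-\<^sup>1 C\<close>. Eliminating \<open>y\<close> and \<open>z\<close> from the eigenvalue equation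
\<open>\<L> v = \<mu> \<Q> v\<close> leaves the real symmetric quadratic pencil
\<open>F(\<mu>) x = (\<mu>\<^sup>2 M\<^sub>2 + \<mu> M\<^sub>1 + M\<^sub>0) x = 0\<close> with \<open>M\<^sub>2 = A + (\<alpha> + 1/\<beta>) E\<close>,
\<open>M\<^sub>1 = S - A - 2\<alpha>E\<close>, \<open>M\<^sub>0 = \<alpha>E - S\<close>. At \<open>\<mu> = -1\<close> its quadratic form is
\<open>x\<^sup>T F(-1) x = 2 (a + \<gamma>b - c)\<close>, so the stated inequality says that this form is positive at \<open>x\<close>.
Both convergence and the inequality on the eigenvectors are shown to be equivalent to a third
condition: \<open>F(-1)\<close> is positive definite on the whole space.

If \<open>F(-1)\<close> is positive definite, the inequality holds at every unit vector. Convergence follows from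
an energy argument that involves no eigenvalues: the errors satisfy the recurrence
\<open>M\<^sub>2 x\<^sub>k\<^sub>+\<^sub>2 + M\<^sub>1 x\<^sub>k\<^sub>+\<^sub>1 + M\<^sub>0 x\<^sub>k = 0\<close>, along which a nonnegative combination of the forms \<open>F(1)\<close> and
\<open>F(-1)\<close> decreases by twice the value at \<open>x\<^sub>k\<^sub>+\<^sub>2 - x\<^sub>k\<close> of the positive definite form \<open>M\<^sub>2 - M\<^sub>0 = A + E/\<beta> + S\<close>
(\<open>energy_identity\<close>, \<open>second_order_recurrence_decay\<close>). Hence consecutive errors approach each other,
and since the nonsingular saddle point matrix maps an error to \<open>\<Q>\<close> applied to such a difference, the errors
themselves tend to zero (\<open>convergent_if_spd\<close>).

If \<open>F(-1)\<close> is not positive definite, then because \<open>F(-s)\<close> is positive definite for large \<open>s\<close>, there is a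
last \<open>s \<ge> 1\<close> at which definiteness fails, and \<open>F(-s)\<close> is singular there (\<open>quadratic_pencil_kernel\<close>).
A kernel vector yields a real eigenvector of the iteration matrix for the eigenvalue \<open>-s \<le> -1\<close>. It makes
the iteration diverge, and its first component is a member of the set of eigenvector components at
which the inequality fails (\<open>critical_eigenvector\<close>).
\<close>

section \<open>Real symmetric matrices and their quadratic forms\<close>

lemma symmetric_inner:
  fixes M :: "real^'n^'n"
  assumes "transpose M = M"
  shows "x \<bullet> (M *v y) = y \<bullet> (M *v x)"
  by (metis assms dot_lmul_matrix inner_commute transpose_matrix_vector)

lemma inner_transpose_mult: "x \<bullet> (transpose M *v y) = (M *v x) \<bullet> y" for M :: "real^'a^'b"
  by (metis dot_lmul_matrix inner_commute transpose_matrix_vector)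

lemma minus_mat_mult: "(- M) *v x = - (M *v x)" for M :: "real^'a^'b"
  by (simp add: matrix_vector_mult_def vec_eq_iff sum_negf)

lemma invertible_if_kernel_trivial:
  fixes M :: "real^'n^'n"
  assumes "\<And>x. M *v x = 0 \<Longrightarrow> x = 0"
  shows "invertible M"
  using assms by (metis invertible_left_inverse matrix_left_invertible_ker)

lemma invertible_spd: "spd M \<Longrightarrow> invertible M"
  by (rule invertible_if_kernel_trivial) (metis inner_zero_right less_irrefl spd_def)

lemma matrix_inv_mult_vec:
  fixes M :: "real^'n^'n"
  assumes "invertible M"
  shows "matrix_inv M *v (M *v x) = x" "M *v (matrix_inv M *v x) = x"
proof -
  have "M ** matrix_inv M = mat 1 \<and> matrix_inv M ** M = mat 1"
    using assms unfolding invertible_def matrix_inv_def by (rule someI_ex)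
  then show "matrix_inv M *v (M *v x) = x" "M *v (matrix_inv M *v x) = x"
    by (simp_all add: matrix_vector_mul_assoc)
qed

lemma tendsto_matrix_vector_mult:
  fixes M :: "real^'n^'m"
  assumes "(f \<longlongrightarrow> l) F"
  shows "((\<lambda>k. M *v f k) \<longlongrightarrow> M *v l) F"
  using assms by (rule bounded_linear.tendsto[OF matrix_vector_mul_bounded_linear])

text \<open>The form attains a positive minimum on the compact unit sphere, and it is homogeneous of degree two.\<close>

lemma spd_coercive:
  fixes M :: "real^'n^'n"
  assumes "spd M"
  obtains m where "m > 0" "\<And>x. m * (norm x)\<^sup>2 \<le> x \<bullet> (M *v x)"
proof -
  have cont: "continuous_on (sphere 0 1) (\<lambda>x. x \<bullet> (M *v x))"
    by (intro continuous_intros)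
  have "sphere (0 :: real^'n) 1 \<noteq> {}"
    by simp
  then obtain e where e: "e \<in> sphere 0 1" "\<And>y. y \<in> sphere 0 1 \<Longrightarrow> e \<bullet> (M *v e) \<le> y \<bullet> (M *v y)"
    using continuous_attains_inf[OF compact_sphere _ cont] by blast
  show thesis
  proof
    show "e \<bullet> (M *v e) > 0"
      using assms e(1) unfolding spd_def by (metis mem_sphere_0 norm_zero zero_neq_one)
    fix x :: "real^'n"
    show "e \<bullet> (M *v e) * (norm x)\<^sup>2 \<le> x \<bullet> (M *v x)"
    proof (cases "x = 0")
      case False
      let ?y = "x /\<^sub>R norm x"
      have "e \<bullet> (M *v e) \<le> ?y \<bullet> (M *v ?y)"
        using False by (intro e(2)) simp
      also have "\<dots> = x \<bullet> (M *v x) / (norm x)\<^sup>2"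
        by (simp add: matrix_vector_mult_scaleR power2_eq_square divide_inverse)
      finally show ?thesis
        using False by (simp add: field_simps)
    qed simp
  qed
qed

lemma tendsto_zero_if_spd_form_tendsto_zero:
  fixes M :: "real^'n^'n"
  assumes "spd M" "((\<lambda>k. f k \<bullet> (M *v f k)) \<longlongrightarrow> 0) F"
  shows "(f \<longlongrightarrow> 0) F"
proof -
  obtain m where m: "m > 0" "\<And>x. m * (norm x)\<^sup>2 \<le> x \<bullet> (M *v x)"
    using spd_coercive[OF assms(1)] by blast
  have "((\<lambda>k. f k \<bullet> (M *v f k) / m) \<longlongrightarrow> 0) F"
    using tendsto_divide_zero[OF assms(2)] by simp
  then have "((\<lambda>k. (norm (f k))\<^sup>2) \<longlongrightarrow> 0) F"
    by (rule tendsto_0_le[where K = 1])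
       (use m in \<open>auto intro!: always_eventually simp: field_simps order_trans[OF _ abs_ge_self]\<close>)
  then have "((\<lambda>k. sqrt ((norm (f k))\<^sup>2)) \<longlongrightarrow> sqrt 0) F"
    by (rule tendsto_real_sqrt)
  then show ?thesis
    by (simp add: tendsto_norm_zero_iff)
qed

text \<open>A zero of a nonnegative form is a minimum, so the gradient \<open>2 M x\<close> vanishes there. The proof moves
from \<open>x\<close> a short way against \<open>q = M x\<close> and would otherwise reach a negative value.\<close>

lemma psd_isotropic_in_kernel:
  fixes M :: "real^'n^'n"
  assumes sym: "transpose M = M" and psd: "\<And>v. 0 \<le> v \<bullet> (M *v v)" and x: "x \<bullet> (M *v x) = 0"
  shows "M *v x = 0"
proof (rule ccontr)
  assume nz: "M *v x \<noteq> 0"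
  define q where "q = M *v x"
  define h where "h = q \<bullet> (M *v q)"
  have qq: "q \<bullet> q > 0" using nz q_def by simp
  have h: "h \<ge> 0" unfolding h_def by (rule psd)
  have form: "(x - t *\<^sub>R q) \<bullet> (M *v (x - t *\<^sub>R q)) = t * (t * h - 2 * (q \<bullet> q))" for t
    using symmetric_inner[OF sym, of x q] x
    by (simp add: matrix_vector_mult_diff_distrib matrix_vector_mult_scaleR inner_diff_left
        inner_diff_right h_def algebra_simps flip: q_def)
  define t where "t = (q \<bullet> q) / (h + 1)"
  have "t > 0" using qq h by (simp add: t_def)
  moreover have "t * h < 2 * (q \<bullet> q)"
  proof -
    have "(q \<bullet> q) * h < 2 * (q \<bullet> q) * (h + 1)"
      using qq h by (simp add: distrib_left add_nonneg_pos)
    then show ?thesis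
      using h by (simp add: t_def pos_divide_less_eq)
  qed
  ultimately show False
    using psd[of "x - t *\<^sub>R q"] unfolding form by (simp add: zero_le_mult_iff)
qed

section \<open>Decay for second-order recurrences\<close>

text \<open>The recurrence tested against \<open>w - u\<close>. Splitting \<open>M2\<close> and \<open>M0\<close> into their mean and half difference,
the mean and \<open>M1\<close> contribute a telescoping term, which is a combination of the pencil's forms at \<open>1\<close>
and \<open>-1\<close>, and the half difference contributes the dissipation.\<close>

lemma energy_identity:
  fixes M0 M1 M2 :: "real^'n^'n"
  assumes sym: "transpose M0 = M0" "transpose M1 = M1" "transpose M2 = M2"
    and rel: "M2 *v w + M1 *v v + M0 *v u = 0"
  shows "((w + v) \<bullet> ((M2 + M1 + M0) *v (w + v)) + (w - v) \<bullet> ((M2 - M1 + M0) *v (w - v)))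
    = ((v + u) \<bullet> ((M2 + M1 + M0) *v (v + u)) + (v - u) \<bullet> ((M2 - M1 + M0) *v (v - u)))
      - 2 * ((w - u) \<bullet> ((M2 - M0) *v (w - u)))"
proof -
  have "(w - u) \<bullet> (M2 *v w + M1 *v v + M0 *v u) = 0"
    by (simp add: rel)
  then show ?thesis
    using symmetric_inner[OF sym(1), of w u] symmetric_inner[OF sym(2), of w u]
      symmetric_inner[OF sym(3), of w u] symmetric_inner[OF sym(1), of w v]
      symmetric_inner[OF sym(2), of w v] symmetric_inner[OF sym(3), of w v]
      symmetric_inner[OF sym(1), of v u] symmetric_inner[OF sym(2), of v u]
      symmetric_inner[OF sym(3), of v u]
    by (simp add: matrix_vector_mult_add_rdistrib matrix_vector_mult_diff_rdistrib
        matrix_vector_right_distrib matrix_vector_mult_diff_distrib inner_add_left inner_add_right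
        inner_diff_left inner_diff_right)
qed

text \<open>The energy \<open>V\<close> is bounded below and decreasing, so the dissipated amounts tend to zero and thus
\<open>x\<^sub>k\<^sub>+\<^sub>2 - x\<^sub>k\<close> does. Up to such differences, two consecutive instances of the recurrence subtract to
\<open>(M2 - M1 + M0) (x\<^sub>k\<^sub>+\<^sub>1 - x\<^sub>k) \<approx> 0\<close>, and the matrix is invertible. Since \<open>M2 + M1 + M0\<close> may be singular,
only its image of \<open>x\<^sub>k\<close> is controlled.\<close>

lemma second_order_recurrence_decay:
  fixes M0 M1 M2 :: "real^'n^'n" and x :: "nat \<Rightarrow> real^'n"
  assumes sym: "transpose M0 = M0" "transpose M1 = M1" "transpose M2 = M2"
    and rel: "\<And>k. M2 *v x (Suc (Suc k)) + M1 *v x (Suc k) + M0 *v x k = 0"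
    and dissip: "spd (M2 - M0)"
    and at_minus_one: "spd (M2 - M1 + M0)"
    and at_one: "\<And>v. 0 \<le> v \<bullet> ((M2 + M1 + M0) *v v)"
  shows "(\<lambda>k. x (Suc k) - x k) \<longlonglongrightarrow> 0"
    and "(\<lambda>k. (M2 + M1 + M0) *v x k) \<longlonglongrightarrow> 0"
proof -
  let ?H = "M2 - M1 + M0"
  define V where "V = (\<lambda>k. (x (Suc k) + x k) \<bullet> ((M2 + M1 + M0) *v (x (Suc k) + x k))
    + (x (Suc k) - x k) \<bullet> (?H *v (x (Suc k) - x k)))"
  define p where "p = (\<lambda>k. x (Suc (Suc k)) - x k)"
  have spd_nonneg: "spd M \<Longrightarrow> 0 \<le> v \<bullet> (M *v v)" for M :: "real^'n^'n" and v
    unfolding spd_def by (cases "v = 0") (auto simp: less_imp_le)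
  have step: "V (Suc k) = V k - 2 * (p k \<bullet> ((M2 - M0) *v p k))" for k
    unfolding V_def p_def by (rule energy_identity[OF sym rel])
  have "V (Suc k) \<le> V k" for k
    using step[of k] spd_nonneg[OF dissip, of "p k"] by simp
  then have "decseq V"
    by (rule decseq_SucI)
  moreover have "0 \<le> V k" for k
    unfolding V_def using spd_nonneg[OF at_minus_one] at_one by (intro add_nonneg_nonneg)
  ultimately obtain l where l: "V \<longlonglongrightarrow> l"
    using decseq_convergent by metis
  have "(\<lambda>k. (V k - V (Suc k)) / 2) \<longlonglongrightarrow> (l - l) / 2"
    by (intro tendsto_intros l LIMSEQ_Suc) simp
  then have "(\<lambda>k. p k \<bullet> ((M2 - M0) *v p k)) \<longlonglongrightarrow> 0"
    by (simp add: step)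
  then have p: "p \<longlonglongrightarrow> 0"
    by (rule tendsto_zero_if_spd_form_tendsto_zero[OF dissip])
  have Hx: "?H *v (x (Suc k) - x k) = M2 *v p k - M1 *v p k - M2 *v p (Suc k)" for k
    using rel[of k] rel[of "Suc k"] unfolding p_def
    by (simp add: matrix_vector_mult_add_rdistrib matrix_vector_mult_diff_rdistrib
        matrix_vector_mult_diff_distrib algebra_simps add_eq_0_iff)
  have "(\<lambda>k. M2 *v p k - M1 *v p k - M2 *v p (Suc k)) \<longlonglongrightarrow> M2 *v 0 - M1 *v 0 - M2 *v 0"
    by (intro tendsto_diff tendsto_matrix_vector_mult p LIMSEQ_Suc)
  then have "(\<lambda>k. ?H *v (x (Suc k) - x k)) \<longlonglongrightarrow> 0"
    by (simp only: Hx) simp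
  from tendsto_matrix_vector_mult[OF this, of "matrix_inv ?H"]
  show inc: "(\<lambda>k. x (Suc k) - x k) \<longlonglongrightarrow> 0"
    by (simp add: matrix_inv_mult_vec invertible_spd at_minus_one)
  have Kx: "(M2 + M1 + M0) *v x k = - (M2 *v p k) - M1 *v (x (Suc k) - x k)" for k
    using rel[of k] unfolding p_def
    by (simp add: matrix_vector_mult_add_rdistrib
        matrix_vector_mult_diff_distrib algebra_simps add_eq_0_iff)
  have "(\<lambda>k. - (M2 *v p k) - M1 *v (x (Suc k) - x k)) \<longlonglongrightarrow> - (M2 *v 0) - M1 *v 0"
    by (intro tendsto_diff tendsto_minus tendsto_matrix_vector_mult p inc)
  then show "(\<lambda>k. (M2 + M1 + M0) *v x k) \<longlonglongrightarrow> 0"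
    by (simp add: Kx)
qed

section \<open>Real roots of quadratic pencils\<close>

text \<open>The pairs \<open>(s, x)\<close> with \<open>s \<ge> 1\<close>, \<open>x\<close> a unit vector and a nonpositive form at \<open>-s\<close> make up a compact
set, since the term \<open>s\<^sup>2 M2\<close> dominates for large \<open>s\<close>. At the largest such \<open>s\<close> the form cannot be
negative anywhere: by continuity a negative value would persist to a larger parameter. It is thus
nonnegative with a zero at \<open>x\<close>, which lies in the kernel.\<close>

lemma quadratic_pencil_kernel:
  fixes M0 M1 M2 :: "real^'n^'n"
  assumes sym: "transpose M0 = M0" "transpose M1 = M1"
    and spd: "spd M2"
    and x0: "x0 \<noteq> 0" "x0 \<bullet> ((M2 - M1 + M0) *v x0) \<le> 0"
  obtains s x where "s \<ge> 1" "norm x = 1" "(s\<^sup>2 *\<^sub>R M2 - s *\<^sub>R M1 + M0) *v x = 0"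
proof -
  define f where "f = (\<lambda>s x. s\<^sup>2 * (x \<bullet> (M2 *v x)) - s * (x \<bullet> (M1 *v x)) + x \<bullet> (M0 *v x))"
  have f: "f s x = x \<bullet> ((s\<^sup>2 *\<^sub>R M2 - s *\<^sub>R M1 + M0) *v x)" for s x
    by (simp add: f_def matrix_vector_mult_add_rdistrib matrix_vector_mult_diff_rdistrib
        scaleR_matrix_vector_assoc[symmetric] inner_add_right inner_diff_right)
  obtain m where m: "m > 0" "\<And>x. m * (norm x)\<^sup>2 \<le> x \<bullet> (M2 *v x)"
    using spd_coercive[OF spd] by blast
  have bnd: "\<exists>c\<ge>0. \<forall>x. norm x = 1 \<longrightarrow> \<bar>x \<bullet> (M *v x)\<bar> \<le> c" for M :: "real^'n^'n"
  proof (intro exI conjI allI impI)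
    show "0 \<le> onorm ((*v) M)"
      by (rule onorm_pos_le) (rule matrix_vector_mul_bounded_linear)
    fix x :: "real^'n" assume x: "norm x = 1"
    have "\<bar>x \<bullet> (M *v x)\<bar> \<le> norm (M *v x)"
      using Cauchy_Schwarz_ineq2[of x "M *v x"] x by simp
    also have "\<dots> \<le> onorm ((*v) M)"
      using onorm[OF matrix_vector_mul_bounded_linear, of M x] x by simp
    finally show "\<bar>x \<bullet> (M *v x)\<bar> \<le> onorm ((*v) M)" .
  qed
  obtain c1 where c1: "c1 \<ge> 0" "\<And>x. norm x = 1 \<Longrightarrow> \<bar>x \<bullet> (M1 *v x)\<bar> \<le> c1"
    using bnd[of M1] by blast
  obtain c0 where c0: "c0 \<ge> 0" "\<And>x. norm x = 1 \<Longrightarrow> \<bar>x \<bullet> (M0 *v x)\<bar> \<le> c0"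
    using bnd[of M0] by blast
  \<comment> \<open>the summand 1 makes the comparison of \<open>s * m\<close> with \<open>c1 + c0\<close> strict for all \<open>s \<ge> S\<close>\<close>
  define S where "S = (c1 + c0) / m + 1"
  have S1: "S \<ge> 1" using c0(1) c1(1) m(1) by (simp add: S_def)
  have big: "f s x > 0" if "s \<ge> S" "norm x = 1" for s x
  proof -
    have s: "s \<ge> 1" using that S1 by simp
    have "c1 + c0 < s * m" using that(1) m(1) by (simp add: S_def field_simps)
    then have "s * (c1 + c0) < s * (s * m)" using s by simp
    moreover have "c0 \<le> s * c0" using s c0(1) by (simp add: mult_le_cancel_right1)
    moreover have "s * (x \<bullet> (M1 *v x)) \<le> s * c1" using s c1(2)[OF that(2)] by simp
    moreover have "s\<^sup>2 * m \<le> s\<^sup>2 * (x \<bullet> (M2 *v x))" using m(2)[of x] that(2) by (intro mult_left_mono) auto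
    ultimately show ?thesis
      using c0(2)[OF that(2)] unfolding f_def by (simp add: power2_eq_square algebra_simps)
  qed
  define T where "T = ({1..S} \<times> sphere 0 1) \<inter> {t. f (fst t) (snd t) \<le> 0}"
  have "closed {t. f (fst t) (snd t) \<le> (0::real)}"
    unfolding f_def
    by (intro closed_Collect_le continuous_intros
        linear_continuous_on_compose[OF _ matrix_vector_mul_linear])
  then have "compact T"
    unfolding T_def by (intro compact_Int_closed compact_Times compact_Icc compact_sphere)
  moreover have "T \<noteq> {}"
  proof -
    let ?y = "x0 /\<^sub>R norm x0"
    have "f 1 ?y = x0 \<bullet> ((M2 - M1 + M0) *v x0) / (norm x0)\<^sup>2"
      by (simp add: f matrix_vector_mult_scaleR power2_eq_square divide_inverse)
    also have "\<dots> \<le> 0" using x0 by (simp add: divide_le_0_iff)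
    finally have "(1, ?y) \<in> T" using x0 S1 by (simp add: T_def)
    then show ?thesis by blast
  qed
  ultimately have "\<exists>t\<in>T. \<forall>t'\<in>T. fst t' \<le> fst t"
    by (intro continuous_attains_sup continuous_intros)
  then obtain t where t: "t \<in> T" "\<And>t'. t' \<in> T \<Longrightarrow> fst t' \<le> fst t"
    by blast
  obtain s x where tsx: "t = (s, x)" by (cases t)
  have s: "1 \<le> s" "s \<le> S" and x: "norm x = 1" and fsx: "f s x \<le> 0"
    using t(1) by (auto simp: tsx T_def)
  have unit_nonneg: "0 \<le> f s y" if y: "norm y = 1" for y
  proof (rule ccontr)
    assume "\<not> 0 \<le> f s y"
    then have neg: "f s y < 0" by simp
    have "\<exists>r\<ge>s. r \<le> S \<and> f r y = 0"
      using neg big[OF order_refl y] s(2)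
      by (intro IVT') (auto simp: f_def intro!: continuous_intros)
    then obtain r where r: "r \<ge> s" "r \<le> S" "f r y = 0" by blast
    then have "(r, y) \<in> T" using s y by (auto simp: T_def)
    then have "r \<le> s" using t(2) tsx by fastforce
    then show False using r neg by simp
  qed
  have nonneg: "0 \<le> f s y" for y
  proof (cases "y = 0")
    case False
    then have "0 \<le> f s (y /\<^sub>R norm y)" by (intro unit_nonneg) simp
    also have "\<dots> = f s y / (norm y)\<^sup>2"
      by (simp add: f matrix_vector_mult_scaleR power2_eq_square divide_inverse)
    finally show ?thesis using False by (simp add: zero_le_divide_iff)
  qed (simp add: f)
  have "(s\<^sup>2 *\<^sub>R M2 - s *\<^sub>R M1 + M0) *v x = 0"
  proof (rule psd_isotropic_in_kernel)
    show "transpose (s\<^sup>2 *\<^sub>R M2 - s *\<^sub>R M1 + M0) = s\<^sup>2 *\<^sub>R M2 - s *\<^sub>R M1 + M0"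
      using sym spd unfolding spd_def by (simp add: vec_eq_iff transpose_def)
    show "0 \<le> v \<bullet> ((s\<^sup>2 *\<^sub>R M2 - s *\<^sub>R M1 + M0) *v v)" for v
      using nonneg by (simp add: f)
    show "x \<bullet> ((s\<^sup>2 *\<^sub>R M2 - s *\<^sub>R M1 + M0) *v x) = 0"
      using nonneg[of x] fsx by (simp add: f)
  qed
  with s x show thesis by (intro that)
qed

section \<open>Stacked vectors and block matrices\<close>

lemma stack3_exhaust:
  obtains x y z where "v = stack3 x y z"
proof
  show "v = stack3 (\<chi> i. v $ Inl i) (\<chi> i. v $ Inr (Inl i)) (\<chi> i. v $ Inr (Inr i))"
    by (simp add: stack3_def vec_eq_iff split: sum.split)
qed

lemma stack3_eq_iff: "stack3 x y z = stack3 x' y' z' \<longleftrightarrow> x = x' \<and> y = y' \<and> z = z'"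
  by (auto simp: stack3_def vec_eq_iff split: sum.splits)

lemma stack3_eq_0_iff: "stack3 x y z = 0 \<longleftrightarrow> x = 0 \<and> y = 0 \<and> z = 0"
  by (auto simp: stack3_def vec_eq_iff split: sum.splits)

lemma stack3_linear:
  fixes x x' :: "real^'n" and y y' :: "real^'m" and z z' :: "real^'p"
  shows "stack3 x y z - stack3 x' y' z' = stack3 (x - x') (y - y') (z - z')"
    and "r *\<^sub>R stack3 x y z = stack3 (r *\<^sub>R x) (r *\<^sub>R y) (r *\<^sub>R z)"
  by (auto simp: stack3_def vec_eq_iff split: sum.splits)

lemma tendsto_stack3_zero:
  fixes x :: "nat \<Rightarrow> real^'n" and y :: "nat \<Rightarrow> real^'m" and z :: "nat \<Rightarrow> real^'p"
  assumes "x \<longlonglongrightarrow> 0" "y \<longlonglongrightarrow> 0" "z \<longlonglongrightarrow> 0"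
  shows "(\<lambda>k. stack3 (x k) (y k) (z k)) \<longlonglongrightarrow> 0"
proof (rule vec_tendstoI)
  fix i :: "'n + 'm + 'p"
  show "(\<lambda>k. stack3 (x k) (y k) (z k) $ i) \<longlonglongrightarrow> 0 $ i"
  proof (cases i)
    case (Inr j)
    with assms(2,3)[THEN tendsto_vec_nth] show ?thesis
      by (cases j) (auto simp: stack3_def)
  qed (use assms(1)[THEN tendsto_vec_nth] in \<open>auto simp: stack3_def\<close>)
qed

lemma block3_mult_stack3:
  "block3 A11 A12 A13 A21 A22 A23 A31 A32 A33 *v stack3 x y z =
    stack3 (A11 *v x + A12 *v y + A13 *v z) (A21 *v x + A22 *v y + A23 *v z)
      (A31 *v x + A32 *v y + A33 *v z)"
  by (simp add: vec_eq_iff block3_def stack3_def matrix_vector_mult_def sum.Plus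
      UNIV_Plus_UNIV[symmetric] add.assoc split: sum.split del: UNIV_Plus_UNIV)

section \<open>The splitting of the saddle point matrix and its pencil\<close>

text \<open>Full row rank of \<open>B\<close> enters as injectivity of its transpose, the form in which it makes the second
component \<open>y\<close> determined by \<open>B\<^sup>T y\<close>.\<close>

locale saddle_splitting =
  fixes A :: "real^'n^'n" and B :: "real^'n^'m" and C :: "real^'n^'p" and D :: "real^'p^'p"
    and \<alpha> \<beta> :: real
  assumes spd_A: "spd A" and spd_D: "spd D"
    and B_transpose_injective: "\<And>y. transpose B *v y = 0 \<Longrightarrow> y = 0"
    and \<alpha>_pos: "\<alpha> > 0" and \<beta>_pos: "\<beta> > 0"
begin

definition E :: "real^'n^'n" where "E = transpose B ** B"
definition S :: "real^'n^'n" where "S = transpose C ** matrix_inv D ** C"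

text \<open>Coefficients of the quadratic pencil in \<open>x\<close> that remains when \<open>z = D\<^sup>-\<^sup>1 C x\<close> and
\<open>y = \<mu> / (\<beta> (\<mu> - 1)) B x\<close> are substituted into the first block row of \<open>\<L> v = \<mu> \<Q> v\<close>, which is then
multiplied by \<open>1 - \<mu>\<close>.\<close>

definition M0 :: "real^'n^'n" where "M0 = \<alpha> *\<^sub>R E - S"
definition M1 :: "real^'n^'n" where "M1 = S - A - (2 * \<alpha>) *\<^sub>R E"
definition M2 :: "real^'n^'n" where "M2 = A + (\<alpha> + 1 / \<beta>) *\<^sub>R E"

lemma E_mult: "E *v x = transpose B *v (B *v x)"
  by (simp add: E_def matrix_vector_mul_assoc del: transpose_matrix_vector)

lemma S_mult: "S *v x = transpose C *v (matrix_inv D *v (C *v x))"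
  by (simp add: S_def matrix_vector_mul_assoc matrix_mul_assoc del: transpose_matrix_vector)

lemma A_form_pos: "x \<noteq> 0 \<Longrightarrow> x \<bullet> (A *v x) > 0"
  using spd_A by (simp add: spd_def)

lemma A_form_nonneg: "x \<bullet> (A *v x) \<ge> 0"
  using A_form_pos[of x] by (cases "x = 0") auto

lemma D_form_nonneg: "z \<bullet> (D *v z) \<ge> 0"
  using spd_D unfolding spd_def by (cases "z = 0") (auto simp: less_imp_le)

lemma D_inverse: "matrix_inv D *v (D *v z) = z" "D *v (matrix_inv D *v z) = z"
  using matrix_inv_mult_vec[OF invertible_spd[OF spd_D]] by auto

lemma E_form: "x \<bullet> (E *v x) = (norm (B *v x))\<^sup>2"
  by (simp add: E_mult inner_transpose_mult power2_norm_eq_inner del: transpose_matrix_vector)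

lemma S_form_nonneg: "x \<bullet> (S *v x) \<ge> 0"
  using D_form_nonneg[of "matrix_inv D *v (C *v x)"]
  by (simp add: S_mult inner_transpose_mult D_inverse inner_commute del: transpose_matrix_vector)

lemma symmetric_E: "transpose E = E"
  by (simp add: E_def matrix_transpose_mul)

lemma symmetric_S: "transpose S = S"
proof -
  have sym: "x \<bullet> (matrix_inv D *v y) = y \<bullet> (matrix_inv D *v x)" for x y
    using symmetric_inner[of D "matrix_inv D *v x" "matrix_inv D *v y"] spd_D
    by (simp add: spd_def D_inverse inner_commute)
  have "x \<bullet> (transpose S *v y) = x \<bullet> (S *v y)" for x y
    using sym[of "C *v x" "C *v y"]
    by (simp add: inner_transpose_mult S_mult inner_commute del: transpose_matrix_vector)
  then show ?thesis
    by (metis matrix_eq vector_eq_rdot inner_commute)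
qed

lemma symmetric_A: "transpose A = A"
  using spd_A by (simp add: spd_def)

lemma symmetric_pencil: "transpose M0 = M0" "transpose M1 = M1" "transpose M2 = M2"
  using symmetric_E symmetric_S symmetric_A
  by (simp_all add: M0_def M1_def M2_def vec_eq_iff transpose_def)

lemmas pencil_expand = M0_def M1_def M2_def matrix_vector_mult_add_rdistrib
  matrix_vector_mult_diff_rdistrib scaleR_matrix_vector_assoc[symmetric]

lemma pencil_form:
  "x \<bullet> ((s\<^sup>2 *\<^sub>R M2 - s *\<^sub>R M1 + M0) *v x) =
    (s\<^sup>2 + s) * (x \<bullet> (A *v x)) + (\<alpha> * (s + 1)\<^sup>2 + s\<^sup>2 / \<beta>) * (x \<bullet> (E *v x))
      - (s + 1) * (x \<bullet> (S *v x))"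
  by (simp add: pencil_expand inner_add_right inner_diff_right)
    (simp add: algebra_simps power2_eq_square)

text \<open>This is where the constant \<open>\<gamma> = 2\<alpha> + 1/(2\<beta>)\<close> of the convergence criterion comes from.\<close>

lemma pencil_form_at_minus_one:
  "x \<bullet> ((M2 - M1 + M0) *v x) =
    2 * (x \<bullet> (A *v x) + (2 * \<alpha> + 1 / (2 * \<beta>)) * (x \<bullet> (E *v x)) - x \<bullet> (S *v x))"
  using pencil_form[of x 1] by (simp add: algebra_simps)

lemma spd_M2: "spd M2"
  unfolding spd_def
proof (intro conjI allI impI)
  fix x :: "real^'n" assume "x \<noteq> 0"
  then show "0 < x \<bullet> (M2 *v x)"
    using A_form_pos[of x] \<alpha>_pos \<beta>_pos
    by (simp add: pencil_expand inner_add_right E_form add_pos_nonneg)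
qed (rule symmetric_pencil)

lemma spd_M2_minus_M0: "spd (M2 - M0)"
  unfolding spd_def
proof (intro conjI allI impI)
  show "transpose (M2 - M0) = M2 - M0"
    using symmetric_pencil by (simp add: vec_eq_iff transpose_def)
  fix x :: "real^'n" assume "x \<noteq> 0"
  then have "0 < x \<bullet> (A *v x) + (1 / \<beta>) * (x \<bullet> (E *v x)) + x \<bullet> (S *v x)"
    using A_form_pos[of x] S_form_nonneg[of x] \<beta>_pos by (simp add: E_form add_pos_nonneg)
  also have "\<dots> = x \<bullet> ((M2 - M0) *v x)"
    by (simp add: pencil_expand inner_add_right inner_diff_right) (simp add: distrib_right)
  finally show "0 < x \<bullet> ((M2 - M0) *v x)" .
qed

lemma pencil_at_one: "(M2 + M1 + M0) *v x = (1 / \<beta>) *\<^sub>R (E *v x)"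
  by (simp add: pencil_expand vec_eq_iff) (simp add: distrib_right)

abbreviation "\<A> \<equiv> saddle_mat A B C D"
abbreviation "\<Q> \<equiv> Q_mat A B C D \<alpha> \<beta>"
abbreviation "\<L> \<equiv> L_mat B C \<alpha> \<beta>"
abbreviation "\<G> \<equiv> G_mat A B C D \<alpha> \<beta>"

lemmas block_expand = block3_mult_stack3 minus_mat_mult matrix_vector_mult_add_rdistrib
  scaleR_matrix_vector_assoc[symmetric] E_def[symmetric]

lemma saddle_mat_mult: "\<A> *v stack3 x y z =
    stack3 (A *v x + transpose B *v y + transpose C *v z) (B *v x) (C *v x - D *v z)"
  by (simp add: saddle_mat_def block_expand)

lemma Q_mat_mult: "\<Q> *v stack3 x y z =
    stack3 (A *v x + \<alpha> *\<^sub>R (E *v x) + transpose B *v y) (B *v x - \<beta> *\<^sub>R y) (C *v x - D *v z)"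
  by (simp add: Q_mat_def block_expand)

lemma L_mat_mult: "\<L> *v stack3 x y z =
    stack3 (\<alpha> *\<^sub>R (E *v x) - transpose C *v z) (- (\<beta> *\<^sub>R y)) 0"
  by (simp add: L_mat_def block_expand)

lemma D_injective: "D *v z = 0 \<Longrightarrow> z = 0"
  by (metis D_inverse(1) matrix_vector_mult_0_right)

text \<open>For \<open>(x; y; z)\<close> in the kernel, testing the first row with \<open>x\<close> gives \<open>x\<^sup>T A x + z\<^sup>T D z = 0\<close>.\<close>

lemma invertible_saddle_mat: "invertible \<A>"
proof (rule invertible_if_kernel_trivial)
  fix v assume v: "\<A> *v v = 0"
  obtain x y z where xyz: "v = stack3 x y z"
    by (rule stack3_exhaust)
  have eqs: "A *v x + transpose B *v y + transpose C *v z = 0" "B *v x = 0" "C *v x = D *v z"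
    using v unfolding xyz saddle_mat_mult stack3_eq_0_iff by simp_all
  have "0 = x \<bullet> (A *v x + transpose B *v y + transpose C *v z)"
    unfolding eqs(1) by simp
  also have "\<dots> = x \<bullet> (A *v x) + z \<bullet> (D *v z)"
    by (simp add: inner_add_right inner_transpose_mult eqs(2,3) inner_commute del: transpose_matrix_vector)
  finally have x: "x = 0"
    using A_form_pos[of x] D_form_nonneg[of z] by fastforce
  then have z: "z = 0"
    using eqs(3) D_injective by simp
  have "y = 0"
    using eqs(1) x z by (intro B_transpose_injective) simp
  then show "v = 0"
    using x z by (simp add: xyz stack3_eq_0_iff)
qed

text \<open>For \<open>(x; y; z)\<close> in the kernel, testing the first row with \<open>x\<close> gives
\<open>x\<^sup>T A x + \<alpha> \<parallel>B x\<parallel>\<^sup>2 + \<beta> \<parallel>y\<parallel>\<^sup>2 = 0\<close>.\<close>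

lemma invertible_Q_mat: "invertible \<Q>"
proof (rule invertible_if_kernel_trivial)
  fix v assume v: "\<Q> *v v = 0"
  obtain x y z where xyz: "v = stack3 x y z"
    by (rule stack3_exhaust)
  have eqs: "A *v x + \<alpha> *\<^sub>R (E *v x) + transpose B *v y = 0" "B *v x = \<beta> *\<^sub>R y" "C *v x = D *v z"
    using v unfolding xyz Q_mat_mult stack3_eq_0_iff by simp_all
  have "0 = x \<bullet> (A *v x + \<alpha> *\<^sub>R (E *v x) + transpose B *v y)"
    unfolding eqs(1) by simp
  also have "\<dots> = x \<bullet> (A *v x) + \<alpha> * (norm (B *v x))\<^sup>2 + \<beta> * (norm y)\<^sup>2"
    by (simp add: inner_add_right E_form inner_transpose_mult eqs(2) power2_norm_eq_inner
        del: transpose_matrix_vector)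
  finally have x: "x = 0"
    using A_form_pos[of x] \<alpha>_pos \<beta>_pos
    by (metis add_pos_nonneg less_irrefl mult_nonneg_nonneg less_imp_le zero_le_power2)
  then show "v = 0"
    using eqs(2,3) \<beta>_pos D_injective[of z] by (simp add: xyz stack3_eq_0_iff)
qed

lemma G_mat_mult: "\<G> *v v = matrix_inv \<Q> *v (\<L> *v v)"
  by (simp add: G_mat_def matrix_vector_mul_assoc)

lemma G_mat_mult_eq_iff: "\<G> *v v = w \<longleftrightarrow> \<L> *v v = \<Q> *v w"
  unfolding G_mat_mult by (metis invertible_Q_mat matrix_inv_mult_vec)

lemma fixed_point:
  assumes "\<A> *v w = d"
  shows "\<G> *v w + matrix_inv \<Q> *v d = w"
proof -
  have "\<L> *v w + d = \<Q> *v w"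
    unfolding assms[symmetric] saddle_mat_splitting[of A B C D \<alpha> \<beta>] matrix_vector_mult_diff_rdistrib
    by simp
  then show ?thesis
    by (simp add: G_mat_mult matrix_inv_mult_vec invertible_Q_mat flip: matrix_vector_right_distrib)
qed

section \<open>Failure of definiteness gives an eigenvalue at most -1\<close>

text \<open>The elimination that produced the pencil, reversed for \<open>\<mu> = -s\<close>: the second block row dictates the
factor of \<open>B x\<close> and the third block row the last component. The division by \<open>s + 1 = 1 - \<mu>\<close> is
harmless since \<open>s \<ge> 1\<close>.\<close>

lemma eigenpair_from_pencil:
  assumes s: "s \<ge> 1" and ker: "(s\<^sup>2 *\<^sub>R M2 - s *\<^sub>R M1 + M0) *v x = 0"
  defines "v \<equiv> stack3 x ((s / (\<beta> * (s + 1))) *\<^sub>R (B *v x)) (matrix_inv D *v (C *v x))"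
  shows "\<G> *v v = (- s) *\<^sub>R v"
proof -
  define r where "r = s / (\<beta> * (s + 1))"
  have r: "r * (\<beta> * (s + 1)) = s"
    using s \<beta>_pos by (simp add: r_def)
  have coeff: "(s + 1) * (s * r) = s\<^sup>2 / \<beta>"
    using s \<beta>_pos by (simp add: r_def power2_eq_square)
  have "(s + 1) *\<^sub>R (\<alpha> *\<^sub>R (E *v x) - S *v x + s *\<^sub>R (A *v x + \<alpha> *\<^sub>R (E *v x) + r *\<^sub>R (E *v x)))
      = (s\<^sup>2 *\<^sub>R M2 - s *\<^sub>R M1 + M0) *v x"
    (is "?l = ?r")
  proof -
    have "?l = (s\<^sup>2 + s) *\<^sub>R (A *v x) + (\<alpha> * (s + 1)\<^sup>2 + (s + 1) * (s * r)) *\<^sub>R (E *v x)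
        - (s + 1) *\<^sub>R (S *v x)"
      by (simp add: vec_eq_iff algebra_simps power2_eq_square)
    also have "\<dots> = ?r"
      unfolding coeff
      by (simp add: pencil_expand vec_eq_iff) (simp add: algebra_simps power2_eq_square)
    finally show ?thesis .
  qed
  then have top: "\<alpha> *\<^sub>R (E *v x) - S *v x = (- s) *\<^sub>R (A *v x + \<alpha> *\<^sub>R (E *v x) + r *\<^sub>R (E *v x))"
    using s ker by (simp add: add_eq_0_iff)
  have mid: "- (\<beta> *\<^sub>R (r *\<^sub>R (B *v x))) = (- s) *\<^sub>R (B *v x - \<beta> *\<^sub>R (r *\<^sub>R (B *v x)))"
  proof -
    have "- (\<beta> * r) = (- s) * (1 - \<beta> * r)"
      using r by (simp add: algebra_simps)
    then have "(- (\<beta> * r)) *\<^sub>R (B *v x) = ((- s) * (1 - \<beta> * r)) *\<^sub>R (B *v x)"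
      by simp
    then show ?thesis
      by (simp add: algebra_simps)
  qed
  have "\<L> *v v = (- s) *\<^sub>R (\<Q> *v v)"
    unfolding v_def r_def[symmetric] L_mat_mult Q_mat_mult stack3_linear stack3_eq_iff
      S_mult[symmetric] D_inverse matrix_vector_mult_scaleR E_mult[symmetric]
    using top mid by simp
  then show ?thesis
    unfolding G_mat_mult_eq_iff matrix_vector_mult_scaleR .
qed

text \<open>A real eigenpair is in particular a complex one.\<close>

lemma D_set_I:
  assumes "norm x = 1" and eig: "\<G> *v stack3 x y z = \<mu> *\<^sub>R stack3 x y z"
  shows "x \<in> D_set A B C D \<alpha> \<beta>"
proof -
  have lift: "map_matrix complex_of_real M *v (\<chi> i. complex_of_real (v $ i)) = (\<chi> i. complex_of_real ((M *v v) $ i))"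
    for M :: "real^'k^'l" and v
    by (simp add: vec_eq_iff matrix_vector_mult_def map_matrix_def)
  let ?w = "stack3 (\<chi> i. complex_of_real (x $ i)) (\<chi> i. complex_of_real (y $ i)) (\<chi> i. complex_of_real (z $ i))"
  have w: "?w = (\<chi> i. complex_of_real (stack3 x y z $ i))"
    by (simp add: stack3_def vec_eq_iff split: sum.split)
  have "map_matrix complex_of_real \<G> *v ?w = complex_of_real \<mu> *s ?w"
    unfolding w lift eig by (simp add: vec_eq_iff)
  moreover have "?w \<noteq> 0"
  proof
    assume "?w = 0"
    then have "x = 0"
      unfolding stack3_eq_0_iff by (simp add: vec_eq_iff)
    then show False
      using assms(1) by simp
  qed
  ultimately show ?thesis
    using assms(1) unfolding D_set_def is_eigenvector_def by blast
qed

text \<open>The vector found by the root argument has a vanishing form at \<open>-s\<close>, while the criterion concerns \<open>-1\<close>.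
The two are linked by comparing coefficients of \<open>a\<close> and \<open>b\<close>, which, relative to their values at \<open>s = 1\<close>,
grow at least as fast as the coefficient \<open>s + 1\<close> of \<open>c\<close>; so the form is nonpositive at \<open>-1\<close> as well.\<close>

lemma critical_eigenvector:
  assumes "\<not> spd (M2 - M1 + M0)"
  obtains s x y z where "s \<ge> 1" "norm x = 1" "\<G> *v stack3 x y z = (- s) *\<^sub>R stack3 x y z"
    "x \<bullet> (S *v x) - x \<bullet> (A *v x) \<ge> (2 * \<alpha> + 1 / (2 * \<beta>)) * (x \<bullet> (E *v x))"
proof -
  have "transpose (M2 - M1 + M0) = M2 - M1 + M0"
    using symmetric_pencil by (simp add: vec_eq_iff transpose_def)
  then obtain x0 where "x0 \<noteq> 0" "x0 \<bullet> ((M2 - M1 + M0) *v x0) \<le> 0"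
    using assms unfolding spd_def by (auto simp: not_less)
  then obtain s x where s: "s \<ge> 1" and x: "norm x = 1"
    and ker: "(s\<^sup>2 *\<^sub>R M2 - s *\<^sub>R M1 + M0) *v x = 0"
    using quadratic_pencil_kernel[OF symmetric_pencil(1,2) spd_M2] by blast
  let ?a = "x \<bullet> (A *v x)" and ?b = "x \<bullet> (E *v x)" and ?c = "x \<bullet> (S *v x)"
  have "(s\<^sup>2 + s) * ?a + (\<alpha> * (s + 1)\<^sup>2 + s\<^sup>2 / \<beta>) * ?b = (s + 1) * ?c"
    using pencil_form[of x s] by (simp add: ker)
  moreover have "(s + 1) * (?a + (2 * \<alpha> + 1 / (2 * \<beta>)) * ?b)
      \<le> (s\<^sup>2 + s) * ?a + (\<alpha> * (s + 1)\<^sup>2 + s\<^sup>2 / \<beta>) * ?b"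
  proof -
    have "0 \<le> (s\<^sup>2 - 1) * ?a + (\<alpha> * (s\<^sup>2 - 1) + (s - 1) * (2 * s + 1) / (2 * \<beta>)) * ?b"
      using s A_form_nonneg[of x] \<alpha>_pos \<beta>_pos
      by (intro add_nonneg_nonneg mult_nonneg_nonneg divide_nonneg_nonneg) (auto simp: E_form)
    also have "\<dots> = (s\<^sup>2 + s) * ?a + (\<alpha> * (s + 1)\<^sup>2 + s\<^sup>2 / \<beta>) * ?b
        - (s + 1) * (?a + (2 * \<alpha> + 1 / (2 * \<beta>)) * ?b)"
      using \<beta>_pos by (simp add: field_simps power2_eq_square)
    finally show ?thesis by simp
  qed
  ultimately have "(s + 1) * (?a + (2 * \<alpha> + 1 / (2 * \<beta>)) * ?b) \<le> (s + 1) * ?c"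
    by simp
  then have "?c - ?a \<ge> (2 * \<alpha> + 1 / (2 * \<beta>)) * ?b"
    using s by simp
  then show thesis
    using that s x eigenpair_from_pencil[OF s ker] by blast
qed

text \<open>Starting at \<open>w + v\<close> with an eigenvector \<open>v\<close>, the errors \<open>(-s)\<^sup>k v\<close> never become shorter than \<open>v\<close>.\<close>

lemma divergent_if_not_spd:
  assumes "\<not> spd (M2 - M1 + M0)" and w: "\<A> *v w = d"
  obtains u :: "nat \<Rightarrow> real^('n + 'm + 'p)" where
    "\<And>k. u (Suc k) = \<G> *v u k + matrix_inv \<Q> *v d" "\<not> u \<longlonglongrightarrow> w"
proof -
  obtain s x y z where s: "s \<ge> 1" and x: "norm x = 1"
    and eig: "\<G> *v stack3 x y z = (- s) *\<^sub>R stack3 x y z"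
    using critical_eigenvector[OF assms(1)] by metis
  define v where "v = stack3 x y z"
  have v: "v \<noteq> 0" using x by (auto simp: v_def stack3_eq_0_iff)
  define u where "u = (\<lambda>k. w + (- s) ^ k *\<^sub>R v)"
  show thesis
  proof
    show "u (Suc k) = \<G> *v u k + matrix_inv \<Q> *v d" for k
      using fixed_point[OF w] eig
      by (simp add: u_def v_def[symmetric] matrix_vector_right_distrib matrix_vector_mult_scaleR
          algebra_simps)
    show "\<not> u \<longlonglongrightarrow> w"
    proof
      assume "u \<longlonglongrightarrow> w"
      then have "(\<lambda>k. norm (u k - w)) \<longlonglongrightarrow> 0"
        by (simp add: LIM_zero tendsto_norm_zero)
      moreover have "norm v \<le> norm (u k - w)" for k
        using s by (simp add: u_def power_abs mult_le_cancel_right1)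
      ultimately have "norm v \<le> 0"
        by (intro LIMSEQ_le_const) auto
      then show False using v by simp
    qed
  qed
qed

section \<open>Definiteness gives convergence\<close>

text \<open>The first component of the error satisfies the pencil's recurrence, obtained by subtracting
consecutive first block rows so that \<open>y\<close> enters only through its increments \<open>B x / \<beta>\<close>. The decay lemma
then makes the increments of all three components vanish: the limit of \<open>F(1) x\<^sub>k = E x\<^sub>k / \<beta>\<close> is zero, and
\<open>B\<^sup>T\<close> has a left inverse. An error \<open>e\<close> and its successor \<open>e'\<close> satisfy
\<open>(\<Q> - \<L>) e = \<Q> (e - e')\<close>, so the saddle point matrix sends the errors to a null sequence.\<close>

lemma convergent_if_spd:
  assumes spd: "spd (M2 - M1 + M0)" and w: "\<A> *v w = d"
    and u: "\<And>k. u (Suc k) = \<G> *v u k + matrix_inv \<Q> *v d"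
  shows "u \<longlonglongrightarrow> w"
proof -
  \<comment> \<open>the index is shifted because \<open>C x = D z\<close> holds for the errors from the first step on,
      but not for an arbitrary initial error\<close>
  define e where "e = (\<lambda>k. u (Suc k) - w)"
  have "\<forall>k. \<exists>x y z. e k = stack3 x y z"
    by (meson stack3_exhaust)
  then obtain x y z where e: "\<And>k. e k = stack3 (x k) (y k) (z k)"
    by metis
  have err: "u (Suc k) - w = \<G> *v (u k - w)" for k
    using fixed_point[OF w] u[of k] by (simp add: matrix_vector_mult_diff_distrib algebra_simps)
  have Qe: "\<Q> *v (u (Suc k) - w) = \<L> *v (u k - w)" for k
    using err[of k] G_mat_mult_eq_iff by metis
  have z: "C *v x k = D *v z k" for k
  proof -
    obtain x' y' z' where "u k - w = stack3 x' y' z'"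
      by (rule stack3_exhaust)
    then show ?thesis
      using Qe[of k] e[of k] by (simp add: e_def Q_mat_mult L_mat_mult stack3_eq_iff)
  qed
  then have z': "z k = matrix_inv D *v (C *v x k)" for k
    by (simp add: D_inverse)
  have "\<Q> *v e (Suc k) = \<L> *v e k" for k
    unfolding e_def by (rule Qe)
  then have top: "A *v x (Suc k) + \<alpha> *\<^sub>R (E *v x (Suc k)) + transpose B *v y (Suc k)
      = \<alpha> *\<^sub>R (E *v x k) - S *v x k"
    and mid: "B *v x (Suc k) - \<beta> *\<^sub>R y (Suc k) = - (\<beta> *\<^sub>R y k)" for k
    unfolding e Q_mat_mult L_mat_mult stack3_eq_iff S_mult z' by blast+
  have y: "y (Suc k) - y k = (1 / \<beta>) *\<^sub>R (B *v x (Suc k))" for k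
  proof -
    have "B *v x (Suc k) = \<beta> *\<^sub>R (y (Suc k) - y k)"
      using mid[of k] by (simp add: algebra_simps)
    then show ?thesis using \<beta>_pos by simp
  qed
  have rec: "M2 *v x (Suc (Suc k)) + M1 *v x (Suc k) + M0 *v x k = 0" for k
  proof -
    have By: "transpose B *v y (Suc j) =
        \<alpha> *\<^sub>R (E *v x j) - S *v x j - A *v x (Suc j) - \<alpha> *\<^sub>R (E *v x (Suc j))" for j
      by (simp only: top[of j, symmetric]) simp
    have "(1 / \<beta>) *\<^sub>R (E *v x (Suc (Suc k))) = transpose B *v (y (Suc (Suc k)) - y (Suc k))"
      by (simp only: E_mult y matrix_vector_mult_scaleR)
    then have "((1 / \<beta>) *\<^sub>R (E *v x (Suc (Suc k)))) $ i
        = (transpose B *v y (Suc (Suc k)) - transpose B *v y (Suc k)) $ i" for i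
      by (simp only: matrix_vector_mult_diff_distrib)
    note component = this[unfolded By]
    show ?thesis
      unfolding vec_eq_iff
    proof
      fix i
      show "(M2 *v x (Suc (Suc k)) + M1 *v x (Suc k) + M0 *v x k) $ i = 0 $ i"
        using component[of i] by (simp add: pencil_expand) (simp add: distrib_right)
    qed
  qed
  have at_one: "0 \<le> v \<bullet> ((M2 + M1 + M0) *v v)" for v
    using \<beta>_pos by (simp add: pencil_at_one E_form)
  note decay = second_order_recurrence_decay[where x = x, OF symmetric_pencil rec spd_M2_minus_M0 spd at_one]
  have dx: "(\<lambda>k. x (Suc k) - x k) \<longlonglongrightarrow> 0"
    by (rule decay(1))
  have dz: "(\<lambda>k. z (Suc k) - z k) \<longlonglongrightarrow> 0"
    using tendsto_matrix_vector_mult[OF tendsto_matrix_vector_mult[OF dx], of "matrix_inv D" C]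
    by (simp add: z' matrix_vector_mult_diff_distrib)
  have dy: "(\<lambda>k. y (Suc k) - y k) \<longlonglongrightarrow> 0"
  proof -
    obtain N where N: "N ** transpose B = mat 1"
      using B_transpose_injective matrix_left_invertible_ker[of "transpose B"] by blast
    have "(\<lambda>k. N *v (1 / \<beta>) *\<^sub>R (E *v x (Suc k))) \<longlonglongrightarrow> N *v 0"
      using LIMSEQ_Suc[OF decay(2)] unfolding pencil_at_one by (rule tendsto_matrix_vector_mult)
    moreover have "N *v (1 / \<beta>) *\<^sub>R (E *v x (Suc k)) = y (Suc k) - y k" for k
      by (simp add: E_mult y matrix_vector_mult_scaleR matrix_vector_mul_assoc N matrix_mul_assoc
        del: transpose_matrix_vector)
    ultimately show ?thesis by simp
  qed
  have "(\<lambda>k. e (Suc k) - e k) \<longlonglongrightarrow> 0"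
    unfolding e stack3_linear by (intro tendsto_stack3_zero dx dy dz)
  from tendsto_matrix_vector_mult[OF tendsto_matrix_vector_mult[OF this], of "matrix_inv \<A>" "- \<Q>"]
  have "(\<lambda>k. matrix_inv \<A> *v (- \<Q> *v (e (Suc k) - e k))) \<longlonglongrightarrow> 0"
    by simp
  moreover have "- \<Q> *v (e (Suc k) - e k) = \<A> *v e k" for k
    using \<open>\<Q> *v e (Suc k) = \<L> *v e k\<close>
    by (simp add: saddle_mat_splitting[of A B C D \<alpha> \<beta>] minus_mat_mult matrix_vector_mult_diff_rdistrib
        matrix_vector_mult_diff_distrib)
  ultimately have "e \<longlonglongrightarrow> 0"
    by (simp add: matrix_inv_mult_vec invertible_saddle_mat)
  then have "(\<lambda>k. u (Suc k)) \<longlonglongrightarrow> w"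
    unfolding e_def by (rule LIM_zero_cancel)
  then show ?thesis
    by (rule LIMSEQ_imp_Suc)
qed

section \<open>The convergence criterion\<close>

lemma spd_iff_D_set_condition:
  "spd (M2 - M1 + M0) \<longleftrightarrow> (\<forall>x \<in> D_set A B C D \<alpha> \<beta>.
    x \<bullet> (S *v x) - x \<bullet> (A *v x) < (2 * \<alpha> + 1 / (2 * \<beta>)) * (x \<bullet> (E *v x)))"
proof
  assume spd: "spd (M2 - M1 + M0)"
  show "\<forall>x \<in> D_set A B C D \<alpha> \<beta>.
    x \<bullet> (S *v x) - x \<bullet> (A *v x) < (2 * \<alpha> + 1 / (2 * \<beta>)) * (x \<bullet> (E *v x))"
  proof
    fix x assume "x \<in> D_set A B C D \<alpha> \<beta>"
    then have "x \<noteq> 0" by (auto simp: D_set_def)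
    then have "0 < x \<bullet> ((M2 - M1 + M0) *v x)"
      using spd by (simp add: spd_def)
    then show "x \<bullet> (S *v x) - x \<bullet> (A *v x) < (2 * \<alpha> + 1 / (2 * \<beta>)) * (x \<bullet> (E *v x))"
      unfolding pencil_form_at_minus_one by simp
  qed
next
  assume cond: "\<forall>x \<in> D_set A B C D \<alpha> \<beta>.
    x \<bullet> (S *v x) - x \<bullet> (A *v x) < (2 * \<alpha> + 1 / (2 * \<beta>)) * (x \<bullet> (E *v x))"
  show "spd (M2 - M1 + M0)"
    by (rule ccontr, erule critical_eigenvector) (use D_set_I cond in fastforce)
qed

end

theorem theorem1:
  fixes A :: "real^'n^'n" and B :: "real^'n^'m" and C :: "real^'n^'p" and D :: "real^'p^'p"
    and \<alpha> \<beta> \<gamma> :: real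
    and d :: "real^('n + 'm + 'p)"
    and a b c :: "real^'n \<Rightarrow> real"
  assumes "spd A" and "spd D"
    and "rank B = CARD('m)"
    and "rank C < min CARD('p) CARD('n)"
    and "\<alpha> > 0" and "\<beta> > 0"
  defines "a \<equiv> \<lambda>x. x \<bullet> (A *v x)"
    and "b \<equiv> \<lambda>x. x \<bullet> ((transpose B ** B) *v x)"
    and "c \<equiv> \<lambda>x. x \<bullet> ((transpose C ** matrix_inv D ** C) *v x)"
    and "\<gamma> \<equiv> 2 * \<alpha> + 1 / (2 * \<beta>)"
  shows "\<exists>w. (\<forall>v. saddle_mat A B C D *v v = d \<longleftrightarrow> v = w) \<and>
    (\<forall>x \<in> D_set A B C D \<alpha> \<beta>. a x > 0 \<and> b x \<ge> 0 \<and> c x \<ge> 0) \<and>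
    ((\<forall>u :: nat \<Rightarrow> real^('n + 'm + 'p).
        (\<forall>k. u (Suc k) = G_mat A B C D \<alpha> \<beta> *v u k + matrix_inv (Q_mat A B C D \<alpha> \<beta>) *v d)
          \<longrightarrow> u \<longlonglongrightarrow> w)
      \<longleftrightarrow> (\<forall>x \<in> D_set A B C D \<alpha> \<beta>. c x - a x < \<gamma> * b x))"
proof -
  have "rank (transpose B) = CARD('m)"
    using assms(3) by (simp add: rank_transpose)
  then have "transpose B *v y = 0 \<Longrightarrow> y = 0" for y
    using matrix_nonfull_linear_equations_eq[of "transpose B"] by blast
  then interpret saddle_splitting A B C D \<alpha> \<beta>
    using assms by unfold_locales
  define w where "w = matrix_inv \<A> *v d"
  have w: "\<A> *v v = d \<longleftrightarrow> v = w" for v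
    unfolding w_def using matrix_inv_mult_vec[OF invertible_saddle_mat] by metis
  have signs: "a x > 0 \<and> b x \<ge> 0 \<and> c x \<ge> 0" if "x \<in> D_set A B C D \<alpha> \<beta>" for x
  proof -
    have "x \<noteq> 0" using that by (auto simp: D_set_def)
    then show ?thesis
      using A_form_pos E_form[of x] S_form_nonneg[of x]
      by (simp add: a_def b_def c_def E_def S_def)
  qed
  have "(\<forall>u. (\<forall>k. u (Suc k) = \<G> *v u k + matrix_inv \<Q> *v d) \<longrightarrow> u \<longlonglongrightarrow> w)
      \<longleftrightarrow> spd (M2 - M1 + M0)"
    using convergent_if_spd divergent_if_not_spd w by metis
  also have "\<dots> \<longleftrightarrow> (\<forall>x \<in> D_set A B C D \<alpha> \<beta>. c x - a x < \<gamma> * b x)"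
    unfolding spd_iff_D_set_condition a_def b_def c_def \<gamma>_def E_def S_def ..
  finally show ?thesis
    using w signs by blast
qed

end
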